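(* Let $n\ge 1$, let $\alpha\subset\{1,\dots,n\}\times\{1,\dots,n\}$, let $\Sigma_\alpha$ be the associated sparse matrix space and let $G$ be the associated directed graph. Suppose that $G$ contains a sequence of nested Hamiltonian subgraphs $G_1\subset G_2\subset\dots\subset G_{n-1}\subset G_n=G$, where for each $k=1,\dots,n$ the subgraph $G_k$ has exactly $k$ vertices and admits a Hamiltonian decomposition. Then $\Sigma_\alpha$ is stable.
   Context: For $\alpha\subset\{1,\dots,n\}\times\{1,\dots,n\}$, the sparse matrix space (SMS) $\Sigma_\alpha\subset\mathbb{R}^{n\times n}$ is the vector space of real $n\times n$ matrices $A=(a_{ij})$ with $a_{ij}=0$ whenever $(i,j)\notin\alpha$ (the entries indexed by $\alpha$ are free). A real square matrix is stable if all its eigenvalues have strictly negative real part. An SMS is stable if it contains a stable matrix, and unstable otherwise. The directed graph associated to $\Sigma_\alpha$ has vertices $v_1,\dots,v_n$ and an edge $(v_i,v_j)$ from $v_i$ to $v_j$ exactly when $(i,j)\in\alpha$; self-loops are allowed. A subgraph of $G=(V,E)$ is a graph $G'=(V',E')$ with $V'\subset V$, $E'\subset E$; this is written $G'\subset G$. Subgraphs are disjoint if their vertex sets are disjoint. A decomposition of a graph is a collection of pairwise disjoint subgraphs whose vertex sets have union the whole vertex set. A Hamiltonian cycle of a directed graph is a directed cycle visiting every vertex exactly once (except that the origin vertex is visited again at the end); for a graph with one vertex this is a self-loop at that vertex, and for a graph with two vertices $u,w$ it consists of the edges $(u,w)$ and $(w,u)$. A Hamiltonian decomposition of a graph is a decomposition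 into disjoint subgraphs each of which admits a Hamiltonian cycle. A Hamiltonian subgraph of $G$ is a subgraph of $G$ that admits a Hamiltonian decomposition. *)

theory Defs
  imports
    Complex_Main
    "Graph_Theory.Digraph_Component"
    "Jordan_Normal_Form.Char_Poly"
begin

text \<open>
  Matrix entries in \<^typ>\<open>real mat\<close> are indexed from 0, whereas \<open>\<alpha> \<subseteq> {1..n} \<times> {1..n}\<close>
  is indexed from 1; hence the shift.
\<close>
definition sms :: "nat \<Rightarrow> (nat \<times> nat) set \<Rightarrow> real mat set" where
  "sms n \<alpha> = {A \<in> carrier_mat n n.
     \<forall>i\<in>{1..n}. \<forall>j\<in>{1..n}. (i, j) \<notin> \<alpha> \<longrightarrow> A $$ (i - 1, j - 1) = 0}"

definition stable_mat :: "real mat \<Rightarrow> bool" where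
  "stable_mat A \<longleftrightarrow> square_mat A \<and>
     (\<forall>z. eigenvalue (map_mat complex_of_real A) z \<longrightarrow> Re z < 0)"

definition stable_sms :: "real mat set \<Rightarrow> bool" where
  "stable_sms S \<longleftrightarrow> (\<exists>A\<in>S. stable_mat A)"

definition sms_graph :: "nat \<Rightarrow> (nat \<times> nat) set \<Rightarrow> (nat, nat \<times> nat) pre_digraph" where
  "sms_graph n \<alpha> = with_proj \<lparr> pverts = {1..n}, parcs = \<alpha> \<rparr>"

text \<open>
  \<^const>\<open>pre_digraph.cycle\<close> is a nonempty closed arc walk without repeated vertices (apart from the
  return to its origin). A self-loop is a cycle of length 1, and two opposite arcs form a cycle of
  length 2. The tails of the arcs are exactly the visited vertices.
\<close>
definition hamiltonian_cycle :: "('a, 'b) pre_digraph \<Rightarrow> 'b awalk \<Rightarrow> bool" where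
  "hamiltonian_cycle G p \<longleftrightarrow> pre_digraph.cycle G p \<and> tail G ` set p = verts G"

definition decomposition :: "('a, 'b) pre_digraph \<Rightarrow> ('a, 'b) pre_digraph set \<Rightarrow> bool" where
  "decomposition G D \<longleftrightarrow>
     (\<forall>H\<in>D. subgraph H G) \<and>
     pairwise (\<lambda>H H'. disjnt (verts H) (verts H')) D \<and>
     (\<Union>H\<in>D. verts H) = verts G"

definition hamiltonian_decomposition ::
  "('a, 'b) pre_digraph \<Rightarrow> ('a, 'b) pre_digraph set \<Rightarrow> bool" where
  "hamiltonian_decomposition G D \<longleftrightarrow>
     decomposition G D \<and> (\<forall>H\<in>D. \<exists>p. hamiltonian_cycle H p)"

definition hamiltonian_subgraph ::
  "('a, 'b) pre_digraph \<Rightarrow> ('a, 'b) pre_digraph \<Rightarrow> bool" where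
  "hamiltonian_subgraph H G \<longleftrightarrow> subgraph H G \<and> (\<exists>D. hamiltonian_decomposition H D)"

end

theory Submission
  imports Defs
begin

text \<open>
  A Hamiltonian decomposition of a graph is the cycle decomposition of a permutation of its vertices
  all of whose steps are arcs. Number the vertices in the order in which the chain
  \<open>G\<^sub>1 \<subseteq> \<dots> \<subseteq> G\<^sub>n\<close> acquires them. Then for each \<open>k\<close> the space of matrices with
  the given zero pattern contains one whose leading \<open>k \<times> k\<close> block is a permutation matrix, so the
  leading minor of order \<open>k\<close>, as a polynomial in the free entries, is not identically zero. Since
  the field is infinite, one matrix in the space has all its leading minors
  nonzero (\<open>common_nonvanishing_leading_minors\<close>).

  Multiplying the rows of a matrix by scalars does not change its zero pattern, and a theorem of
  Fisher and Fuller says that a matrix with nonzero leading minors becomes stable after a suitable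
  row scaling (\<open>fisher_fuller\<close>). The scalars are chosen one row at a time, each very small
  compared with the previous ones: with a zero as last row, the characteristic polynomial
  of the next block is \<open>x \<cdot> \<chi>\<^sub>k(x)\<close>, where \<open>\<chi>\<^sub>k\<close> has its roots in the open left half-plane.
  A small last row barely moves these roots and moves the extra root \<open>0\<close> along the real axis by a
  nonzero amount, because the next minor is nonzero; the sign of the scalar decides the direction
  (\<open>hurwitz_perturbation\<close>).
\<close>

section \<open>Small perturbations of stable polynomials\<close>

lemma poly_growth_bound:
  fixes q :: "complex poly"
  shows "\<exists>C\<ge>0. \<forall>z. norm (poly q z) \<le> C * (1 + norm z) ^ degree q"
proof (induction q)
  case 0
  show ?case
    by auto
next
  case (pCons a q)
  show ?case
  proof (cases "q = 0")
    case True
    then show ?thesis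
      by (intro exI[of _ "norm a"]) simp
  next
    case False
    obtain C where C: "C \<ge> 0" "\<And>z. norm (poly q z) \<le> C * (1 + norm z) ^ degree q"
      using pCons.IH by blast
    have "norm (poly (pCons a q) z) \<le> (norm a + C) * (1 + norm z) ^ degree (pCons a q)" for z
    proof -
      have "norm (poly (pCons a q) z) \<le> norm a + norm z * norm (poly q z)"
        using norm_triangle_ineq[of a "z * poly q z"] by (simp add: norm_mult)
      also have "norm z * norm (poly q z) \<le> (1 + norm z) * (C * (1 + norm z) ^ degree q)"
        using C(2)[of z] by (intro mult_mono) auto
      also have "norm a \<le> norm a * (1 + norm z) ^ Suc (degree q)"
        using mult_left_mono[OF one_le_power[of "1 + norm z" "Suc (degree q)"], of "norm a"] by simp
      finally show ?thesis
        using False by (simp add: algebra_simps)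
    qed
    then show ?thesis
      using C(1) by (intro exI[of _ "norm a + C"]) auto
  qed
qed

text \<open>
  Split \<open>p\<close> into linear factors. A root \<open>r\<close> to the left of the imaginary axis has distance at
  least \<open>- Re r\<close> from every point \<open>z\<close> with \<open>Re z \<ge> 0\<close>, and together with the triangle inequality
  this makes \<open>1 + |z|\<close> at most a constant times \<open>|z - r|\<close>.
\<close>
lemma poly_lower_bound_right_half_plane:
  fixes p :: "complex poly"
  assumes "\<And>z. poly p z = 0 \<Longrightarrow> Re z < 0"
  shows "\<exists>K>0. \<forall>z. Re z \<ge> 0 \<longrightarrow> (1 + norm z) ^ degree p \<le> K * norm (poly p z)"
  using assms
proof (induction "degree p" arbitrary: p)
  case 0
  then obtain c where "p = [:c:]"
    by (metis degree_eq_zeroE)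
  moreover have "c \<noteq> 0"
    using 0(2)[of 0] \<open>p = [:c:]\<close> by auto
  ultimately show ?case
    by (intro exI[of _ "1 / norm c"]) auto
next
  case (Suc m)
  then obtain r where "poly p r = 0"
    using fundamental_theorem_of_algebra[of p] constant_degree[of p] by auto
  then obtain s where p: "p = [:- r, 1:] * s"
    by (metis dvdE poly_eq_0_iff_dvd)
  then have "s \<noteq> 0"
    using Suc.hyps(2) by auto
  then have "degree p = Suc (degree s)"
    unfolding p by (subst degree_mult_eq) auto
  moreover have "Re z < 0" if "poly s z = 0" for z
    using Suc.prems that by (simp add: p)
  ultimately obtain K where "K > 0"
    and K: "\<And>z. Re z \<ge> 0 \<Longrightarrow> (1 + norm z) ^ degree s \<le> K * norm (poly s z)"
    using Suc.hyps by (metis Suc_inject)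
  define b where "b = - Re r"
  have "b > 0"
    using Suc.prems[OF \<open>poly p r = 0\<close>] by (simp add: b_def)
  define L where "L = 1 + (norm r + 1) / b"
  have "L > 0"
    using \<open>b > 0\<close> by (simp add: L_def add_pos_nonneg)
  have L: "1 + norm z \<le> L * norm (z - r)" if "Re z \<ge> 0" for z
  proof -
    have "b \<le> norm (z - r)"
      using that abs_Re_le_cmod[of "z - r"] by (simp add: b_def)
    then have "(norm r + 1) * 1 \<le> (norm r + 1) * (norm (z - r) / b)"
      using \<open>b > 0\<close> by (intro mult_left_mono) auto
    moreover have "norm z \<le> norm (z - r) + norm r"
      using norm_triangle_ineq[of "z - r" r] by simp
    ultimately show ?thesis
      by (simp add: L_def algebra_simps add_divide_distrib)
  qed
  have "(1 + norm z) ^ degree p \<le> (L * K) * norm (poly p z)" if "Re z \<ge> 0" for z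
  proof -
    have "(1 + norm z) * (1 + norm z) ^ degree s \<le> (L * norm (z - r)) * (K * norm (poly s z))"
      using L[OF that] K[OF that] \<open>L > 0\<close> by (intro mult_mono) auto
    then show ?thesis
      unfolding \<open>degree p = Suc (degree s)\<close> by (simp add: p norm_mult mult_ac flip: left_diff_distrib)
  qed
  then show ?case
    using \<open>L > 0\<close> \<open>K > 0\<close> by (intro exI[of _ "L * K"]) auto
qed

text \<open>
  For small \<open>\<epsilon>\<close>, a root of \<open>x p + \<epsilon> q\<close> in the closed right half-plane is impossible. Away
  from \<open>0\<close>, the growth bounds make \<open>|q|\<close> at most a constant times \<open>|x p|\<close>, so \<open>\<epsilon> q\<close> cannot cancel
  \<open>x p\<close>. Near \<open>0\<close>, the equation reads \<open>z = - \<epsilon> q(z) / p(z)\<close>, and the quotient keeps the positive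
  real part that it has at \<open>0\<close>.
\<close>
lemma hurwitz_perturbation:
  fixes p q :: "complex poly"
  assumes roots: "\<And>z. poly p z = 0 \<Longrightarrow> Re z < 0"
    and deg: "degree q \<le> Suc (degree p)"
    and pos: "Re (poly q 0 / poly p 0) > 0"
  shows "\<exists>\<epsilon>>0. \<forall>z. poly (pCons 0 p + Polynomial.smult (complex_of_real \<epsilon>) q) z = 0 \<longrightarrow> Re z < 0"
proof -
  have "poly p 0 \<noteq> 0"
    using roots[of 0] by auto
  then have "isCont (\<lambda>z. Re (poly q z / poly p z)) 0"
    by (intro continuous_Re isCont_divide poly_isCont)
  then have "\<forall>\<^sub>F z in at 0. Re (poly q z / poly p z) > 0"
    using pos by (auto simp: isCont_def intro: order_tendstoD(1))
  then obtain \<delta> where "\<delta> > 0"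
    and near: "\<And>z. norm z < \<delta> \<Longrightarrow> Re (poly q z / poly p z) > 0"
    using pos unfolding eventually_at by (metis UNIV_I dist_norm diff_zero)
  obtain K where "K > 0"
    and K: "\<And>z. Re z \<ge> 0 \<Longrightarrow> (1 + norm z) ^ degree p \<le> K * norm (poly p z)"
    using poly_lower_bound_right_half_plane[OF roots] by blast
  obtain C where "C \<ge> 0" and C: "\<And>z. norm (poly q z) \<le> C * (1 + norm z) ^ degree q"
    using poly_growth_bound by blast
  define B where "B = C * (1 / \<delta> + 1) * K + 1"
  have "B > 0"
    using \<open>\<delta> > 0\<close> \<open>K > 0\<close> \<open>C \<ge> 0\<close> by (simp add: B_def add_nonneg_pos)
  have far: "norm (poly q z) < B * norm (z * poly p z)" if z: "Re z \<ge> 0" "norm z \<ge> \<delta>" for z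
  proof -
    have "1 \<le> norm z / \<delta>"
      using z \<open>\<delta> > 0\<close> by simp
    then have "1 + norm z \<le> (1 / \<delta> + 1) * norm z"
      by (simp add: algebra_simps)
    then have "(1 + norm z) * (1 + norm z) ^ degree p \<le> ((1 / \<delta> + 1) * norm z) * (K * norm (poly p z))"
      using K[OF z(1)] \<open>\<delta> > 0\<close> by (intro mult_mono) auto
    moreover have "(1 + norm z) ^ degree q \<le> (1 + norm z) ^ Suc (degree p)"
      using deg by (intro power_increasing) auto
    ultimately have "C * (1 + norm z) ^ degree q \<le> C * (((1 / \<delta> + 1) * norm z) * (K * norm (poly p z)))"
      using \<open>C \<ge> 0\<close> by (intro mult_left_mono) auto
    then have "norm (poly q z) \<le> (C * (1 / \<delta> + 1) * K) * norm (z * poly p z)"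
      using C[of z] by (simp add: norm_mult mult_ac)
    moreover have "norm (z * poly p z) > 0"
      using z roots[of z] \<open>\<delta> > 0\<close> by auto
    ultimately show ?thesis
      unfolding B_def distrib_right by linarith
  qed
  have "Re z < 0" if root: "poly (pCons 0 p + Polynomial.smult (complex_of_real (1 / B)) q) z = 0" for z
  proof (rule ccontr)
    assume "\<not> Re z < 0"
    then have "Re z \<ge> 0" and "poly p z \<noteq> 0"
      using roots[of z] by auto
    have eq: "z * poly p z = - (poly q z / B)"
      using root by (simp add: eq_neg_iff_add_eq_0)
    show False
    proof (cases "norm z < \<delta>")
      case True
      have "z = z * poly p z / poly p z"
        using \<open>poly p z \<noteq> 0\<close> by simp
      also have "\<dots> = - (poly q z / poly p z / complex_of_real B)"
        unfolding eq by simp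
      finally have "Re z = Re (- (poly q z / poly p z / complex_of_real B))"
        by (rule arg_cong)
      also have "\<dots> = - (Re (poly q z / poly p z) / B)"
        by (simp only: uminus_complex.sel Re_divide_of_real)
      finally have "Re z = - (Re (poly q z / poly p z) / B)" .
      then show False
        using divide_pos_pos[OF near[OF True] \<open>B > 0\<close>] \<open>Re z \<ge> 0\<close> by linarith
    next
      case False
      have "B * norm (z * poly p z) = norm (poly q z)"
        unfolding eq using \<open>B > 0\<close> by (simp add: norm_divide)
      then show False
        using far[OF \<open>Re z \<ge> 0\<close>] False by linarith
    qed
  qed
  moreover have "1 / B > 0"
    using \<open>B > 0\<close> by simp
  ultimately show ?thesis
    by blast
qed

section \<open>Row scaling of matrices with nonzero leading minors\<close>

text \<open>
  Matrices are given by their entry function on all pairs of indices, so that the blocks of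
  different orders come from the same object.
\<close>
definition leading_block :: "nat \<Rightarrow> (nat \<Rightarrow> nat \<Rightarrow> 'a) \<Rightarrow> 'a mat" where
  "leading_block k a = mat k k (\<lambda>(i, j). a i j)"

lemma leading_block_carrier [simp]: "leading_block k a \<in> carrier_mat k k"
  by (simp add: leading_block_def)

lemma leading_block_index [simp]:
  "i < k \<Longrightarrow> j < k \<Longrightarrow> leading_block k a $$ (i, j) = a i j"
  by (simp add: leading_block_def)

lemma leading_block_dim [simp]:
  "dim_row (leading_block k a) = k" "dim_col (leading_block k a) = k"
  by (simp_all add: leading_block_def)

lemma leading_block_cong:
  assumes "\<And>i j. i < k \<Longrightarrow> j < k \<Longrightarrow> a i j = b i j"
  shows "leading_block k a = leading_block k b"
  using assms by (intro eq_matI) auto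

lemma det_scale_rows:
  fixes a :: "nat \<Rightarrow> nat \<Rightarrow> 'a :: comm_ring_1"
  shows "det (leading_block k (\<lambda>i j. d i * a i j)) = (\<Prod>i<k. d i) * det (leading_block k a)"
proof -
  have "(\<Prod>i = 0..<k. leading_block k (\<lambda>i j. d i * a i j) $$ (i, p i))
      = (\<Prod>i<k. d i) * (\<Prod>i = 0..<k. leading_block k a $$ (i, p i))"
    if "p permutes {0..<k}" for p
  proof -
    have "p i < k" if "i < k" for i
      using permutes_in_image[OF \<open>p permutes {0..<k}\<close>, of i] that by simp
    then show ?thesis
      by (simp add: lessThan_atLeast0 flip: prod.distrib)
  qed
  then show ?thesis
    by (auto simp: det_def'[of _ k] sum_distrib_left mult.left_commute intro!: sum.cong)
qed

text \<open>
  Laplace expansion along the last row: its cofactors do not involve the row itself, so the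
  characteristic polynomial is affine in the scalar. The term \<open>x\<close> of the diagonal entry contributes
  \<open>x\<close> times the characteristic polynomial of the smaller block.
\<close>
lemma char_poly_scale_last_row:
  fixes a :: "nat \<Rightarrow> nat \<Rightarrow> real" and k :: nat
  defines "M \<equiv> (\<lambda>\<epsilon>. leading_block (Suc k) (\<lambda>i j. if i = k then \<epsilon> * a i j else a i j))"
  shows "\<exists>q. \<forall>\<epsilon>. char_poly (M \<epsilon>) = pCons 0 (char_poly (leading_block k a)) + Polynomial.smult \<epsilon> q"
proof -
  define X where "X = (\<lambda>\<epsilon>. char_poly_matrix (M \<epsilon>))"
  have X: "X \<epsilon> \<in> carrier_mat (Suc k) (Suc k)" for \<epsilon>
    by (simp add: X_def M_def)
  have cof: "cofactor (X \<epsilon>) k j = cofactor (X 0) k j" if "j < Suc k" for \<epsilon> j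
    unfolding cofactor_def
    by (intro arg_cong[where f = "\<lambda>x. _ * det x"] eq_matI)
      (auto simp: mat_delete_def X_def M_def char_poly_matrix_def)
  have "mat_delete (X 0) k k = char_poly_matrix (leading_block k a)"
    by (intro eq_matI) (auto simp: mat_delete_def X_def M_def char_poly_matrix_def)
  then have last: "cofactor (X 0) k k = char_poly (leading_block k a)"
    by (simp add: cofactor_def char_poly_def)
  define q where "q = (\<Sum>j<Suc k. [:- a k j:] * cofactor (X 0) k j)"
  have "char_poly (M \<epsilon>) = pCons 0 (char_poly (leading_block k a)) + Polynomial.smult \<epsilon> q" for \<epsilon>
  proof -
    have "char_poly (M \<epsilon>) = (\<Sum>j<Suc k. X \<epsilon> $$ (k, j) * cofactor (X \<epsilon>) k j)"
      using laplace_expansion_row[OF X, of k \<epsilon>] by (simp add: char_poly_def X_def)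
    also have "\<dots> = (\<Sum>j<Suc k. (if j = k then [:0, 1:] * cofactor (X 0) k j else 0)
        + Polynomial.smult \<epsilon> ([:- a k j:] * cofactor (X 0) k j))"
    proof (rule sum.cong[OF refl])
      fix j assume "j \<in> {..<Suc k}"
      then have "X \<epsilon> $$ (k, j) = (if j = k then [:0, 1:] else 0) + Polynomial.smult \<epsilon> [:- a k j:]"
        by (auto simp: X_def M_def char_poly_matrix_def)
      then show "X \<epsilon> $$ (k, j) * cofactor (X \<epsilon>) k j
          = (if j = k then [:0, 1:] * cofactor (X 0) k j else 0)
            + Polynomial.smult \<epsilon> ([:- a k j:] * cofactor (X 0) k j)"
        using cof[of j \<epsilon>] \<open>j \<in> {..<Suc k}\<close> by (simp add: algebra_simps)
    qed
    also have "\<dots> = pCons 0 (cofactor (X 0) k k) + Polynomial.smult \<epsilon> q"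
      by (simp only: sum.distrib sum.delta finite_lessThan q_def smult_sum2) simp
    finally show ?thesis
      by (simp add: last)
  qed
  then show ?thesis
    by blast
qed

lemma stable_mat_char_poly:
  assumes "A \<in> carrier_mat n n"
  shows "stable_mat A \<longleftrightarrow>
    (\<forall>z. poly (map_poly complex_of_real (char_poly A)) z = 0 \<longrightarrow> Re z < 0)"
  using assms
  by (auto simp: stable_mat_def eigenvalue_root_char_poly[of _ n] of_real_hom.char_poly_hom[of _ n])

text \<open>
  Only the scalar of the last row is new in each induction step. The nonzero scalars are part of
  the induction because the constant term of the perturbing polynomial \<open>q\<close> is, up to sign, the
  determinant of the block with rows scaled by \<open>d\<^sub>0, \<dots>, d\<^sub>k\<^sub>-\<^sub>1, 1\<close>, and this is the product of
  the scalars with the leading minor.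
\<close>
lemma fisher_fuller:
  fixes a :: "nat \<Rightarrow> nat \<Rightarrow> real"
  assumes "\<And>k. k \<in> {1..n} \<Longrightarrow> det (leading_block k a) \<noteq> 0"
  shows "\<exists>d. (\<forall>i<n. d i \<noteq> 0) \<and> stable_mat (leading_block n (\<lambda>i j. d i * a i j))"
  using assms
proof (induction n)
  case 0
  have "char_poly (leading_block 0 a) = 1" for a :: "nat \<Rightarrow> nat \<Rightarrow> real"
    by (simp add: char_poly_def det_dim_zero)
  then show ?case
    by (simp add: stable_mat_char_poly[of _ 0])
next
  case (Suc k)
  then obtain d where nz: "\<And>i. i < k \<Longrightarrow> d i \<noteq> 0"
    and stable: "stable_mat (leading_block k (\<lambda>i j. d i * a i j))"
    by auto
  let ?D = "\<lambda>\<epsilon>. d(k := \<epsilon>)"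
  define b where "b = (\<lambda>i j. ?D 1 i * a i j)"
  define M where "M = (\<lambda>\<epsilon>. leading_block (Suc k) (\<lambda>i j. ?D \<epsilon> i * a i j))"
  define p where "p = char_poly (leading_block k b)"
  have M: "M \<epsilon> \<in> carrier_mat (Suc k) (Suc k)" for \<epsilon>
    by (simp add: M_def)
  have "leading_block k b = leading_block k (\<lambda>i j. d i * a i j)"
    by (intro leading_block_cong) (simp add: b_def)
  then have p: "Re z < 0" if "poly (map_poly complex_of_real p) z = 0" for z
    using stable that by (simp add: p_def stable_mat_char_poly[of _ k])
  obtain q where q: "\<And>\<epsilon>. char_poly (M \<epsilon>) = pCons 0 p + Polynomial.smult \<epsilon> q"
  proof -
    have "M \<epsilon> = leading_block (Suc k) (\<lambda>i j. if i = k then \<epsilon> * b i j else b i j)" for \<epsilon>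
      unfolding M_def by (intro leading_block_cong) (simp add: b_def)
    then show thesis
      using char_poly_scale_last_row[of k b] that by (auto simp: p_def)
  qed
  have "degree p = k"
    using degree_monic_char_poly[of "leading_block k b" k] by (simp add: p_def)
  \<comment> \<open>The affine family takes a characteristic polynomial as its value at \<open>\<epsilon> = 1\<close>.\<close>
  have "degree q \<le> Suc k"
  proof -
    have "q = char_poly (M 1) - pCons 0 p"
      using q[of 1] by simp
    moreover have "degree (char_poly (M 1)) \<le> Suc k"
      using degree_monic_char_poly[OF M] by simp
    moreover have "degree (pCons 0 p) \<le> Suc k"
      using degree_pCons_le[of 0 p] \<open>degree p = k\<close> by simp
    ultimately show ?thesis
      by (metis degree_diff_le)
  qed
  have "poly p 0 \<noteq> 0"
    using p[of 0] by (auto simp: of_real_hom.poly_map_poly_0)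
  have "poly q 0 \<noteq> 0"
  proof -
    have "det (M 1) \<noteq> 0"
      using nz Suc.prems[of "Suc k"] by (auto simp: M_def det_scale_rows)
    moreover have "char_matrix (M 1) 0 = M 1"
      using M[of 1] by (intro eq_matI) (auto simp: char_matrix_def)
    ultimately have "poly (char_poly (M 1)) 0 \<noteq> 0"
      using eigenvalue_root_char_poly[OF M] eigenvalue_det[OF M] by metis
    then show ?thesis
      by (simp add: q)
  qed
  \<comment> \<open>The sign of the new scalar: it makes the quotient positive, so that the extra root moves left.\<close>
  define s where "s = sgn (poly q 0 / poly p 0)"
  have "s * poly q 0 / poly p 0 > 0" and "s \<noteq> 0"
    using \<open>poly p 0 \<noteq> 0\<close> \<open>poly q 0 \<noteq> 0\<close> by (auto simp: s_def sgn_if zero_less_divide_iff divide_less_0_iff)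
  let ?c = "map_poly complex_of_real"
  have "\<exists>\<epsilon>>0. \<forall>z. poly (pCons 0 (?c p) + Polynomial.smult (complex_of_real \<epsilon>) (?c (Polynomial.smult s q))) z = 0 \<longrightarrow> Re z < 0"
  proof (rule hurwitz_perturbation[OF p])
    show "degree (?c (Polynomial.smult s q)) \<le> Suc (degree (?c p))"
      using \<open>degree q \<le> Suc k\<close> \<open>degree p = k\<close> by simp
    have "poly (?c (Polynomial.smult s q)) 0 / poly (?c p) 0 = complex_of_real (s * poly q 0 / poly p 0)"
      by simp
    then show "Re (poly (?c (Polynomial.smult s q)) 0 / poly (?c p) 0) > 0"
      using \<open>s * poly q 0 / poly p 0 > 0\<close> by simp
  qed
  then obtain \<epsilon> where "\<epsilon> > 0"
    and roots: "\<And>z. poly (pCons 0 (?c p) + Polynomial.smult (complex_of_real \<epsilon>) (?c (Polynomial.smult s q))) z = 0 \<Longrightarrow> Re z < 0"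
    by blast
  have "?c (char_poly (M (\<epsilon> * s))) = pCons 0 (?c p) + Polynomial.smult (complex_of_real \<epsilon>) (?c (Polynomial.smult s q))"
    unfolding q by (simp add: hom_distribs)
  then have "stable_mat (M (\<epsilon> * s))"
    using roots by (simp add: stable_mat_char_poly[OF M])
  moreover have "\<forall>i<Suc k. ?D (\<epsilon> * s) i \<noteq> 0"
    using nz \<open>\<epsilon> > 0\<close> \<open>s \<noteq> 0\<close> by (auto simp: less_Suc_eq)
  ultimately show ?case
    unfolding M_def by blast
qed

section \<open>Generic matrices with a given zero pattern\<close>

lemma det_permutation_block_nonzero:
  assumes "bij_betw \<rho> {..<k} {..<k}"
  shows "det (leading_block k (\<lambda>i j. if \<rho> i = j then 1 else 0 :: real)) \<noteq> 0"
proof -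
  define p where "p = (\<lambda>i. if i < k then \<rho> i else i)"
  have "bij_betw p {..<k} {..<k}"
    using assms by (subst bij_betw_cong[where g = \<rho>]) (auto simp: p_def)
  then have p: "p permutes {0..<k}"
    by (intro bij_imp_permutes) (auto simp: p_def lessThan_atLeast0)
  have "leading_block k (\<lambda>i j. if \<rho> i = j then 1 else 0 :: real)
      = mat k k (\<lambda>(i, j). 1\<^sub>m k $$ (p i, j))"
    using bij_betwE[OF assms] by (intro eq_matI) (auto simp: p_def)
  then show ?thesis
    using det_permute_rows[OF one_carrier_mat p, where ?'a = real] by (simp add: sign_def)
qed

text \<open>
  On the line through a matrix \<open>a\<close> that serves all earlier orders and a matrix \<open>P\<close> that serves the
  new one, each minor is a polynomial in the parameter. None of these polynomials vanishes
  identically: the old ones are nonzero at \<open>a\<close> and the new one at \<open>P\<close>. Hence they all are nonzero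
  outside a finite set of parameters.
\<close>
lemma common_nonvanishing_leading_minors:
  fixes E :: "nat \<Rightarrow> nat \<Rightarrow> bool"
  assumes "finite K"
    and "\<And>k. k \<in> K \<Longrightarrow> \<exists>P :: nat \<Rightarrow> nat \<Rightarrow> real.
      (\<forall>i j. \<not> E i j \<longrightarrow> P i j = 0) \<and> det (leading_block k P) \<noteq> 0"
  shows "\<exists>a :: nat \<Rightarrow> nat \<Rightarrow> real.
    (\<forall>i j. \<not> E i j \<longrightarrow> a i j = 0) \<and> (\<forall>k\<in>K. det (leading_block k a) \<noteq> 0)"
  using assms
proof (induction K)
  case empty
  then show ?case
    by (auto intro: exI[of _ "\<lambda>_ _. 0"])
next
  case (insert m K)
  obtain a :: "nat \<Rightarrow> nat \<Rightarrow> real" where a: "\<And>i j. \<not> E i j \<Longrightarrow> a i j = 0"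
    and detK: "\<And>k. k \<in> K \<Longrightarrow> det (leading_block k a) \<noteq> 0"
    using insert.IH insert.prems by (metis insertCI)
  obtain P :: "nat \<Rightarrow> nat \<Rightarrow> real" where P: "\<And>i j. \<not> E i j \<Longrightarrow> P i j = 0"
    and detm: "det (leading_block m P) \<noteq> 0"
    using insert.prems by blast
  define c where "c = (\<lambda>t i j. a i j + t * (P i j - a i j))"
  define f where "f = (\<lambda>k. det (leading_block k (\<lambda>i j. [:a i j, P i j - a i j:])))"
  have f: "poly (f k) t = det (leading_block k (c t))" for k t
    unfolding f_def by (rule poly_det_cong[of _ k]) (auto simp: c_def)
  have "f k \<noteq> 0" if "k \<in> K" for k
    using f[of k 0] detK[OF that] by (auto simp: c_def)
  moreover have "f m \<noteq> 0"
    using f[of m 1] detm by (auto simp: c_def)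
  ultimately have "finite (\<Union>k\<in>insert m K. {t. poly (f k) t = 0})"
    using insert.hyps by (auto intro: poly_roots_finite)
  then obtain t where "t \<notin> (\<Union>k\<in>insert m K. {t. poly (f k) t = 0})"
    using ex_new_if_finite[OF infinite_UNIV_char_0] by blast
  then have "\<forall>k\<in>insert m K. det (leading_block k (c t)) \<noteq> 0"
    by (auto simp flip: f)
  moreover have "\<forall>i j. \<not> E i j \<longrightarrow> c t i j = 0"
    using a P by (simp add: c_def)
  ultimately show ?case
    by blast
qed

section \<open>Reordering the vertices\<close>

text \<open>
  An eigenvector of the reordered matrix, read in the original order, is an eigenvector of \<open>A\<close> for
  the same eigenvalue.
\<close>
lemma stable_mat_reindex:
  assumes A: "A \<in> carrier_mat n n" and "stable_mat A" and \<pi>: "bij_betw \<pi> {..<n} {..<n}"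
  shows "stable_mat (mat n n (\<lambda>(i, j). A $$ (\<pi> i, \<pi> j)))" (is "stable_mat ?B")
proof -
  have "Re z < 0" if ev: "eigenvalue (map_mat complex_of_real ?B) z" for z
  proof -
    obtain v where v: "v \<in> carrier_vec n" "v \<noteq> 0\<^sub>v n"
      and eq: "map_mat complex_of_real ?B *\<^sub>v v = z \<cdot>\<^sub>v v"
      using ev by (auto simp: eigenvalue_def eigenvector_def)
    define \<sigma> where "\<sigma> = inv_into {..<n} \<pi>"
    have \<sigma>: "\<sigma> l < n" "\<pi> (\<sigma> l) = l" if "l < n" for l
      using that bij_betw_inv_into_right[OF \<pi>, of l] bij_betwE[OF bij_betw_inv_into[OF \<pi>]]
      by (auto simp: \<sigma>_def)
    have \<pi>lt: "\<pi> i < n" and \<sigma>\<pi>: "\<sigma> (\<pi> i) = i" if "i < n" for i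
      using that bij_betwE[OF \<pi>] bij_betw_inv_into_left[OF \<pi>, of i] by (auto simp: \<sigma>_def)
    define u where "u = vec n (\<lambda>l. v $ \<sigma> l)"
    have "u \<noteq> 0\<^sub>v n"
    proof
      assume "u = 0\<^sub>v n"
      have "v $ i = 0" if "i < n" for i
      proof -
        have "u $ \<pi> i = v $ i"
          using that by (simp add: u_def \<pi>lt \<sigma>\<pi>)
        then show ?thesis
          using \<open>u = 0\<^sub>v n\<close> that by (simp add: \<pi>lt)
      qed
      then have "v = 0\<^sub>v n"
        using v(1) by (intro eq_vecI) auto
      then show False
        using v(2) by contradiction
    qed
    moreover have "map_mat complex_of_real A *\<^sub>v u = z \<cdot>\<^sub>v u"
    proof (rule eq_vecI)
      fix l assume "l < dim_vec (z \<cdot>\<^sub>v u)"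
      then have "l < n"
        by (simp add: u_def)
      have "(map_mat complex_of_real A *\<^sub>v u) $ l
          = (\<Sum>m<n. complex_of_real (A $$ (l, m)) * v $ \<sigma> m)"
        using A \<open>l < n\<close> by (simp add: scalar_prod_def u_def lessThan_atLeast0)
      also have "\<dots> = (\<Sum>j<n. complex_of_real (A $$ (l, \<pi> j)) * v $ j)"
        by (rule sum.reindex_bij_betw[OF \<pi>, symmetric, THEN trans]) (simp add: \<sigma>\<pi>)
      also have "\<dots> = (map_mat complex_of_real ?B *\<^sub>v v) $ \<sigma> l"
        using v \<open>l < n\<close> by (simp add: scalar_prod_def \<sigma> lessThan_atLeast0)
      also have "\<dots> = (z \<cdot>\<^sub>v u) $ l"
        using v \<open>l < n\<close> by (simp add: eq u_def \<sigma>)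
      finally show "(map_mat complex_of_real A *\<^sub>v u) $ l = (z \<cdot>\<^sub>v u) $ l" .
    qed (use A in \<open>simp add: u_def\<close>)
    ultimately have "eigenvector (map_mat complex_of_real A) u z"
      using A by (auto simp: eigenvector_def u_def)
    then show "Re z < 0"
      using \<open>stable_mat A\<close> by (auto simp: stable_mat_def eigenvalue_def)
  qed
  then show ?thesis
    by (simp add: stable_mat_def)
qed

text \<open>
  Each set of the chain adds exactly one element to its predecessor; list these elements in order.
\<close>
lemma enumerate_chain:
  fixes V :: "nat \<Rightarrow> 'a set"
  assumes fin: "\<And>k. k \<le> n \<Longrightarrow> finite (V k)" and card: "\<And>k. k \<le> n \<Longrightarrow> card (V k) = k"
    and mono: "\<And>k. k < n \<Longrightarrow> V k \<subseteq> V (Suc k)"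
  shows "\<exists>f. \<forall>k\<le>n. bij_betw f {..<k} (V k)"
proof -
  have "\<exists>x. V (Suc k) = insert x (V k)" if "k < n" for k
  proof -
    have "card (V (Suc k) - V k) = 1"
      using that by (simp add: card_Diff_subset fin card mono)
    then obtain x where "V (Suc k) - V k = {x}"
      by (auto simp: card_1_singleton_iff)
    then show ?thesis
      using mono[OF that] by blast
  qed
  then obtain f where f: "\<And>k. k < n \<Longrightarrow> V (Suc k) = insert (f k) (V k)"
    by metis
  have image: "f ` {..<k} = V k" if "k \<le> n" for k
    using that
  proof (induction k)
    case 0
    then show ?case
      using fin[of 0] card[of 0] by simp
  next
    case (Suc k)
    then show ?case
      using f[of k] by (simp add: lessThan_Suc)
  qed
  have "bij_betw f {..<k} (V k)" if "k \<le> n" for k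
    using image[OF that] card[OF that] by (auto simp: bij_betw_def intro: eq_card_imp_inj_on)
  then show ?thesis
    by blast
qed

section \<open>Hamiltonian decompositions as permutations\<close>

lemma cycle_arcs_distinct_heads:
  assumes "pre_digraph.cycle H p"
  shows "set p \<subseteq> arcs H" and "inj_on (head H) (set p)"
proof -
  obtain u where u: "pre_digraph.awalk H u p u" "distinct (tl (pre_digraph.awalk_verts H u p))" "p \<noteq> []"
    using assms unfolding pre_digraph.cycle_def by blast
  then show "set p \<subseteq> arcs H"
    by (simp add: pre_digraph.awalk_def)
  have "tl (pre_digraph.awalk_verts H u p) = map (head H) p"
    using u pre_digraph.awalk_verts_conv'[of H u p u] by (simp add: pre_digraph.awalk_def)
  then show "inj_on (head H) (set p)"
    using u(2) by (simp add: distinct_map)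
qed

text \<open>
  Send a vertex to its successor on the Hamiltonian cycle of its component. Two vertices with the
  same successor lie in the same component, and on one cycle no two arcs have the same head; so the
  map is injective, and bijective by finiteness.
\<close>
lemma hamiltonian_decomposition_successor:
  assumes "hamiltonian_decomposition G D" and "finite (verts G)"
  shows "\<exists>s. bij_betw s (verts G) (verts G) \<and>
    (\<forall>x\<in>verts G. \<exists>e\<in>arcs G. tail G e = x \<and> head G e = s x)"
proof -
  have sub: "subgraph H G" if "H \<in> D" for H
    using assms that by (auto simp: hamiltonian_decomposition_def decomposition_def)
  have proj: "tail H = tail G" "head H = head G" "arcs H \<subseteq> arcs G" "wf_digraph H" if "H \<in> D" for H
    using sub[OF that] by (auto simp: subgraph_def compatible_def)
  have disj: "H = H'" if "H \<in> D" "H' \<in> D" "x \<in> verts H" "x \<in> verts H'" for H H' x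
    using assms that unfolding hamiltonian_decomposition_def decomposition_def pairwise_def disjnt_def
    by blast
  have union: "(\<Union>H\<in>D. verts H) = verts G"
    using assms(1) by (simp add: hamiltonian_decomposition_def decomposition_def)
  obtain cyc where cyc: "\<And>H. H \<in> D \<Longrightarrow> hamiltonian_cycle H (cyc H)"
    using assms unfolding hamiltonian_decomposition_def by metis
  have cyc_cycle: "pre_digraph.cycle H (cyc H)" if "H \<in> D" for H
    using cyc[OF that] by (simp add: hamiltonian_cycle_def)
  have "\<exists>H e. H \<in> D \<and> e \<in> set (cyc H) \<and> tail G e = x" if "x \<in> verts G" for x
  proof -
    have "x \<in> (\<Union>H\<in>D. verts H)"
      unfolding union by (rule that)
    then obtain H where H: "H \<in> D" "x \<in> verts H"
      by (rule UN_E)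
    have "tail G ` set (cyc H) = verts H"
      using cyc[OF H(1)] by (simp add: hamiltonian_cycle_def proj(1)[OF H(1)])
    then obtain e where "e \<in> set (cyc H)" "tail G e = x"
      using H(2) by (metis imageE)
    then show ?thesis
      using H(1) by blast
  qed
  then obtain comp arc where choice:
    "\<And>x. x \<in> verts G \<Longrightarrow> comp x \<in> D \<and> arc x \<in> set (cyc (comp x)) \<and> tail G (arc x) = x"
    by metis
  define s where "s = (\<lambda>x. head G (arc x))"
  have arc: "arc x \<in> arcs (comp x)" if "x \<in> verts G" for x
    using choice[OF that] cycle_arcs_distinct_heads(1)[OF cyc_cycle, of "comp x"] by (meson subsetD)
  have s_comp: "s x \<in> verts (comp x)" if "x \<in> verts G" for x
    using wf_digraph.head_in_verts[OF proj(4) arc[OF that]] choice[OF that] proj(2) by (auto simp: s_def)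
  have "inj_on s (verts G)"
  proof (rule inj_onI)
    fix x y assume xy: "x \<in> verts G" "y \<in> verts G" "s x = s y"
    then have same: "comp x = comp y"
      using s_comp[of x] s_comp[of y] choice disj by metis
    then have "arc x \<in> set (cyc (comp x))" "arc y \<in> set (cyc (comp x))" "comp x \<in> D"
      using choice[OF xy(1)] choice[OF xy(2)] by (simp_all add: same)
    moreover have "inj_on (head G) (set (cyc (comp x)))"
      using cycle_arcs_distinct_heads(2)[OF cyc_cycle[OF \<open>comp x \<in> D\<close>]] by (simp add: proj(2)[OF \<open>comp x \<in> D\<close>])
    ultimately have "arc x = arc y"
      using xy(3) by (auto simp: s_def dest: inj_onD)
    then have "tail G (arc x) = tail G (arc y)"
      by (rule arg_cong)
    then show "x = y"
      by (rule box_equals) (use choice xy in blast)+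
  qed
  moreover have "s ` verts G \<subseteq> verts G"
  proof (rule image_subsetI)
    fix x assume x: "x \<in> verts G"
    have "verts (comp x) \<subseteq> verts G"
      using choice[OF x] sub[of "comp x"] by (simp add: subgraph_def)
    then show "s x \<in> verts G"
      using s_comp[OF x] by (rule subsetD)
  qed
  ultimately have "bij_betw s (verts G) (verts G)"
    using assms(2) by (simp add: bij_betw_def endo_inj_surj)
  moreover have "\<exists>e\<in>arcs G. tail G e = x \<and> head G e = s x" if "x \<in> verts G" for x
    using choice[OF that] arc[OF that] proj(3)[of "comp x"] by (intro bexI[of _ "arc x"]) (auto simp: s_def)
  ultimately show ?thesis
    by blast
qed

section \<open>Stability of the sparse matrix space\<close>

theorem theorem3:
  fixes n :: nat and \<alpha> :: "(nat \<times> nat) set"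
    and Gs :: "nat \<Rightarrow> (nat, nat \<times> nat) pre_digraph"
  assumes "n \<ge> 1"
    and "\<alpha> \<subseteq> {1..n} \<times> {1..n}"
    and "\<And>k. k \<in> {1..n} \<Longrightarrow> hamiltonian_subgraph (Gs k) (sms_graph n \<alpha>)"
    and "\<And>k. k \<in> {1..n} \<Longrightarrow> card (verts (Gs k)) = k"
    and "\<And>k. k \<in> {1..<n} \<Longrightarrow> subgraph (Gs k) (Gs (k + 1))"
    and "Gs n = sms_graph n \<alpha>"
  shows "stable_sms (sms n \<alpha>)"
proof -
  \<comment> \<open>The chain is prolonged by the empty set, so that the first vertex is enumerated like the others.\<close>
  define V where "V = (\<lambda>k. if k = 0 then {} else verts (Gs k))"
  have sub: "subgraph (Gs k) (sms_graph n \<alpha>)" if "k \<in> {1..n}" for k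
    using assms(3)[OF that] by (simp add: hamiltonian_subgraph_def)
  have fin: "finite (verts (Gs k))" if "k \<in> {1..n}" for k
    using assms(4)[OF that] that by (intro card_ge_0_finite) auto
  have "\<exists>f. \<forall>k\<le>n. bij_betw f {..<k} (V k)"
  proof (rule enumerate_chain)
    show "finite (V k)" "card (V k) = k" if "k \<le> n" for k
      using that fin assms(4) by (auto simp: V_def)
    show "V k \<subseteq> V (Suc k)" if "k < n" for k
      using that assms(5)[of k] by (auto simp: V_def subgraph_def)
  qed
  then obtain f where "\<And>k. k \<le> n \<Longrightarrow> bij_betw f {..<k} (V k)"
    by blast
  then have f: "bij_betw f {..<k} (verts (Gs k))" if "k \<in> {1..n}" for k
    using that by (force simp: V_def)
  have f_n: "bij_betw f {..<n} {1..n}"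
    using f[of n] assms(1,6) by (simp add: sms_graph_def)
  define E where "E = (\<lambda>i j. (f i, f j) \<in> \<alpha>)"
  have "\<exists>P :: nat \<Rightarrow> nat \<Rightarrow> real. (\<forall>i j. \<not> E i j \<longrightarrow> P i j = 0) \<and> det (leading_block k P) \<noteq> 0"
    if k: "k \<in> {1..n}" for k
  proof -
    obtain D where "hamiltonian_decomposition (Gs k) D"
      using assms(3)[OF k] by (auto simp: hamiltonian_subgraph_def)
    then obtain s where s: "bij_betw s (verts (Gs k)) (verts (Gs k))"
      and arcs: "\<And>x. x \<in> verts (Gs k) \<Longrightarrow> \<exists>e\<in>arcs (Gs k). tail (Gs k) e = x \<and> head (Gs k) e = s x"
      using hamiltonian_decomposition_successor[OF _ fin[OF k]] by blast
    have s_\<alpha>: "(x, s x) \<in> \<alpha>" if "x \<in> verts (Gs k)" for x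
      using arcs[OF that] sub[OF k] by (auto simp: subgraph_def compatible_def sms_graph_def)
    define g where "g = inv_into {..<k} f"
    define \<rho> where "\<rho> = g \<circ> s \<circ> f"
    have "bij_betw \<rho> {..<k} {..<k}"
      unfolding \<rho>_def g_def
      using f[OF k] s bij_betw_inv_into[OF f[OF k]] by (blast intro: bij_betw_trans)
    have f_\<rho>: "f (\<rho> i) = s (f i)" if "i < k" for i
      using that bij_betwE[OF f[OF k]] bij_betwE[OF s] bij_betw_inv_into_right[OF f[OF k]]
      by (auto simp: \<rho>_def g_def)
    define P where "P = (\<lambda>i j. if i < k \<and> \<rho> i = j then 1 else 0 :: real)"
    have "leading_block k P = leading_block k (\<lambda>i j. if \<rho> i = j then 1 else 0)"
      by (intro leading_block_cong) (simp add: P_def)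
    then have "det (leading_block k P) \<noteq> 0"
      using det_permutation_block_nonzero[OF \<open>bij_betw \<rho> {..<k} {..<k}\<close>] by simp
    moreover have "P i j = 0" if "\<not> E i j" for i j
      using that s_\<alpha>[of "f i"] bij_betwE[OF f[OF k]] f_\<rho>[of i] by (auto simp: P_def E_def)
    ultimately show ?thesis
      by blast
  qed
  then obtain a :: "nat \<Rightarrow> nat \<Rightarrow> real" where a: "\<And>i j. \<not> E i j \<Longrightarrow> a i j = 0"
    and minors: "\<And>k. k \<in> {1..n} \<Longrightarrow> det (leading_block k a) \<noteq> 0"
    using common_nonvanishing_leading_minors[of "{1..n}" E] by (metis finite_atLeastAtMost)
  obtain d where stable: "stable_mat (leading_block n (\<lambda>i j. d i * a i j))"
    using fisher_fuller[OF minors] by blast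
  \<comment> \<open>Row \<open>i\<close> of the final matrix belongs to the vertex \<open>Suc i\<close>, which is the vertex with number \<open>\<pi> i\<close>.\<close>
  define \<pi> where "\<pi> = inv_into {..<n} f \<circ> Suc"
  have "bij_betw Suc {..<n} {1..n}"
    by (simp add: bij_betw_def lessThan_atLeast0 image_Suc_atLeastLessThan atLeastLessThanSuc_atLeastAtMost)
  then have \<pi>: "bij_betw \<pi> {..<n} {..<n}"
    unfolding \<pi>_def using bij_betw_inv_into[OF f_n] by (rule bij_betw_trans)
  have f_\<pi>: "f (\<pi> i) = Suc i" if "i < n" for i
    using that bij_betw_inv_into_right[OF f_n, of "Suc i"] by (simp add: \<pi>_def)
  define A where "A = mat n n (\<lambda>(i, j). leading_block n (\<lambda>i j. d i * a i j) $$ (\<pi> i, \<pi> j))"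
  have "stable_mat A"
    unfolding A_def by (rule stable_mat_reindex[OF leading_block_carrier stable \<pi>])
  moreover have "A \<in> sms n \<alpha>"
  proof -
    have "A $$ (i - 1, j - 1) = 0" if "i \<in> {1..n}" "j \<in> {1..n}" "(i, j) \<notin> \<alpha>" for i j
    proof -
      have "i - 1 < n" "j - 1 < n"
        using that by auto
      moreover have "\<not> E (\<pi> (i - 1)) (\<pi> (j - 1))"
        using that f_\<pi>[OF \<open>i - 1 < n\<close>] f_\<pi>[OF \<open>j - 1 < n\<close>] by (simp add: E_def)
      ultimately show ?thesis
        using bij_betwE[OF \<pi>] by (auto simp: A_def a)
    qed
    then show ?thesis
      by (simp add: sms_def A_def)
  qed
  ultimately show ?thesis
    by (auto simp: stable_sms_def)
qed

end
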